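(* Let $P_n$ denote the path on $n$ vertices and let $n \ge 6$. If $n \equiv 0 \pmod 5$ or $n \equiv 4 \pmod 5$, then $$\iota_{\rm g}(P_n)=\left\lceil\frac{2n}{5}\right\rceil-1 \qquad\text{and}\qquad \iota_{\rm g}'(P_n)=\left\lfloor\frac{2n+2}{5}\right\rfloor.$$
   Context: For a graph $G$ and $X\subseteq V(G)$, $N_G[X]$ denotes the set of vertices in $X$ or adjacent to a vertex of $X$. The isolation game on a finite graph $G$ is played by two players, Dominator and Staller, who alternately select vertices of $G$. If $X$ is the set of vertices selected so far, a vertex $x$ may be selected (is playable) only if $x$ dominates (i.e., equals or is adjacent to) some vertex belonging to a component of $G - N_G[X]$ with at least two vertices. The game ends when no playable vertex exists. Dominator aims to minimize the total number of selected vertices, Staller aims to maximize it. The game isolation number $\iota_{\rm g}(G)$ is the number of vertices selected when Dominator makes the first move and both play optimally; $\iota_{\rm g}'(G)$ is the same quantity when Staller makes the first move. *)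

theory Defs
  imports Complex_Main "Graph_Theory.Digraph_Component"
begin

text \<open>
  A finite simple graph is a finite, loop-free, symmetric digraph without parallel arcs
  (locale \<open>graph\<close> of the AFP entry Graph Theory). In a symmetric digraph the strongly
  connected components (\<open>sccs\<close>) are the connected components of the graph.
\<close>

datatype player = Dominator | Staller

context graph
begin

definition closed_neighborhood :: "'a set \<Rightarrow> 'a set" where
  "closed_neighborhood X = X \<union> {v \<in> verts G. \<exists>u\<in>X. u \<rightarrow> v}"

definition components_left :: "'a set \<Rightarrow> ('a, 'b) pre_digraph set" where
  "components_left X = pre_digraph.sccs (G \<restriction> (verts G - closed_neighborhood X))"

definition playable :: "'a set \<Rightarrow> 'a set" where
  "playable X = {x \<in> verts G. \<exists>C \<in> components_left X. card (verts C) \<ge> 2 \<and>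
     (\<exists>v \<in> verts C. v \<in> closed_neighborhood {x})}"

lemma components_left_verts:
  assumes "C \<in> components_left X"
  shows "verts C \<subseteq> verts G - closed_neighborhood X"
  using pre_digraph.in_sccs_imp_induced[OF assms[unfolded components_left_def]]
  by (auto simp: induced_subgraph_def subgraph_def)

lemma playable_new:
  assumes "x \<in> playable X"
  shows "x \<in> verts G" "x \<notin> X"
  using assms components_left_verts[of _ X]
  by (auto simp: playable_def closed_neighborhood_def)

text \<open>
  \<open>moves_left p X\<close> is the number of vertices still to be selected, under optimal play,
  when \<open>X\<close> is the set of vertices selected so far and player \<open>p\<close> is to move.
\<close>

function moves_left :: "player \<Rightarrow> 'a set \<Rightarrow> nat" where
  "moves_left Dominator X = (if playable X = {} then 0
     else 1 + Min ((\<lambda>x. moves_left Staller (insert x X)) ` playable X))"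
| "moves_left Staller X = (if playable X = {} then 0
     else 1 + Max ((\<lambda>x. moves_left Dominator (insert x X)) ` playable X))"
  by pat_completeness auto
termination
proof (relation "measure (\<lambda>(p, X). card (verts G - X))", goal_cases)
  case 1
  show ?case by simp
next
  case (2 X x)
  then have "verts G - insert x X \<subset> verts G - X"
    using playable_new[of x X] by auto
  then show ?case by (simp add: psubset_card_mono)
next
  case (3 X x)
  then have "verts G - insert x X \<subset> verts G - X"
    using playable_new[of x X] by auto
  then show ?case by (simp add: psubset_card_mono)
qed

declare moves_left.simps [simp del]

definition game_isolation_number :: nat where
  "game_isolation_number = moves_left Dominator {}"

definition staller_game_isolation_number :: nat where
  "staller_game_isolation_number = moves_left Staller {}"

end

definition path_graph :: "nat \<Rightarrow> (nat, nat \<times> nat) pre_digraph" where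
  "path_graph n = with_proj
     \<lparr> pverts = {1..n},
       parcs = {(i, j). i \<in> {1..n} \<and> j \<in> {1..n} \<and> (j = Suc i \<or> i = Suc j)} \<rparr>"

lemma graph_path_graph: "graph (path_graph n)"
proof -
  have fin: "finite {(i, j). i \<in> {1..n} \<and> j \<in> {1..n} \<and> (j = Suc i \<or> i = Suc j)}"
    by (rule finite_subset[of _ "{1..n} \<times> {1..n}"]) auto
  show ?thesis
    unfolding path_graph_def using fin
    by unfold_locales (auto simp: symmetric_def arcs_ends_def arc_to_ends_def sym_def)
qed

end

theory Submission
  imports Defs
begin

text \<open>
  Let \<open>U\<close> be the set of undominated vertices. The game ends when no edge is left inside \<open>U\<close>.

  Lower bound: a move removes at most three consecutive vertices from \<open>U\<close>, hence at most
  4 edges. Once a vertex has been played, some component of \<open>U\<close> with at least two vertices has a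
  dominated vertex next to one of its ends; by playing that vertex Staller removes exactly the
  end vertex, hence only 1 edge.

  Upper bound: weigh \<open>U\<close> by its number of edges plus 3 for every component with at least two
  vertices. Every move lowers this weight: splitting a component gains 3 but costs 4 edges.
  Dominator can always lower it by 4, either by clearing a component with at most 5 vertices or by
  playing the third vertex of a longer one, which leaves its first vertex isolated. As the last
  component needs no surcharge, 3 is subtracted from the total.

  So both bounds are played with a counter that Dominator lowers by 4 and Staller by 1. It starts
  at \<open>n - 1\<close>, except that for the lower bound Staller opens with an end of the path,
  leaving \<open>n - 3\<close> edges.
\<close>

section \<open>Counting rounds for a weight lowered by 4 and by 1 in turn\<close>

text \<open>
  \<open>dom_rounds w\<close> and \<open>stall_rounds w\<close> count the moves until a weight \<open>w\<close> is used up when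
  Dominator always takes 4 and Staller always takes 1, starting with Dominator and Staller
  respectively.
\<close>

definition dom_rounds :: "nat \<Rightarrow> nat" where
  "dom_rounds w = (w + 4) div 5 + w div 5"

definition stall_rounds :: "nat \<Rightarrow> nat" where
  "stall_rounds w = (w + 4) div 5 + (w + 3) div 5"

lemma dom_rounds_mono: "v \<le> w \<Longrightarrow> dom_rounds v \<le> dom_rounds w"
  unfolding dom_rounds_def by (intro add_mono div_le_mono) auto

lemma stall_rounds_mono: "v \<le> w \<Longrightarrow> stall_rounds v \<le> stall_rounds w"
  unfolding stall_rounds_def by (intro add_mono div_le_mono) auto

text \<open>Adding 5 to a numerator adds one round. For \<open>w\<close> below 4 the truncated
  \<open>w - 4\<close> is 0: one Dominator move uses up the remainder.\<close>

lemma dom_rounds_rec: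
  assumes "w > 0"
  shows "dom_rounds w = Suc (stall_rounds (w - 4))"
proof (cases "w \<ge> 4")
  case True
  then obtain v where v: "w = v + 4" using le_Suc_ex by (metis add.commute)
  have "(v + 8) div 5 = Suc ((v + 3) div 5)"
    using div_add_self2[of 5 "v + 3"] by simp
  then show ?thesis by (simp add: v dom_rounds_def stall_rounds_def)
next
  case False
  then have "w \<in> {1, 2, 3}" using assms by auto
  then show ?thesis by (auto simp: dom_rounds_def stall_rounds_def)
qed

lemma stall_rounds_rec:
  assumes "w > 0"
  shows "stall_rounds w = Suc (dom_rounds (w - 1))"
proof -
  obtain v where "w = Suc v" using assms gr0_conv_Suc by blast
  then show ?thesis using div_add_self2[of 5 v] by (simp add: dom_rounds_def stall_rounds_def)
qed

lemma rounds_0: "dom_rounds 0 = 0" "stall_rounds 0 = 0"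
  by (simp_all add: dom_rounds_def stall_rounds_def)

section \<open>Playability without components\<close>

context graph
begin

text \<open>The first step of a walk to another vertex of the component gives a neighbour in
  \<open>U\<close>. Conversely, the component reachable from \<open>v\<close> contains that
  neighbour.\<close>

lemma live_in_component_iff:
  assumes "H = G \<restriction> U" "U \<subseteq> verts G"
  shows "(\<exists>C \<in> pre_digraph.sccs H. card (verts C) \<ge> 2 \<and> v \<in> verts C)
     \<longleftrightarrow> v \<in> U \<and> (\<exists>w\<in>U. v \<rightarrow> w)"
proof -
  have ind: "induced_subgraph H G" using assms by auto
  then interpret H: digraph H by (rule digraphI_induced)
  interpret H: sym_digraph H using ind by (rule induced_graph_imp_graph)
  have vH: "verts H = U" using assms by simp
  have adj: "x \<rightarrow>\<^bsub>H\<^esub> y \<longleftrightarrow> x \<in> U \<and> y \<in> U \<and> x \<rightarrow> y" for x y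
    unfolding assms(1) arcs_ends_def arc_to_ends_def
    by (auto simp: induce_subgraph_def)
  show ?thesis
  proof
    assume "\<exists>C \<in> H.sccs. card (verts C) \<ge> 2 \<and> v \<in> verts C"
    then obtain C where C: "C \<in> H.sccs" "card (verts C) \<ge> 2" "v \<in> verts C" by blast
    then have "\<not> verts C \<subseteq> {v}"
      by (metis card.empty card.insert card_mono empty_iff finite.emptyI finite.insertI
          not_less_eq_eq numeral_2_eq_2)
    then obtain w where w: "w \<in> verts C" "w \<noteq> v" by blast
    have "verts C \<in> H.sccs_verts" using C(1) H.sccs_verts_conv by auto
    then have "v \<rightarrow>\<^sup>*\<^bsub>H\<^esub> w" using C(3) w(1) by (auto simp: H.sccs_verts_def)
    then obtain u where "v \<rightarrow>\<^bsub>H\<^esub> u"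
      using w(2) by (metis H.converse_reachable_cases)
    then show "v \<in> U \<and> (\<exists>w\<in>U. v \<rightarrow> w)" using adj by blast
  next
    assume "v \<in> U \<and> (\<exists>w\<in>U. v \<rightarrow> w)"
    then obtain w where w: "v \<in> U" "w \<in> U" "v \<rightarrow> w" by blast
    then have vw: "v \<rightarrow>\<^bsub>H\<^esub> w" "v \<noteq> w" using adj adj_not_same by auto
    let ?C = "H \<restriction> {u. v \<rightarrow>\<^sup>*\<^bsub>H\<^esub> u}"
    have C: "?C \<in> H.sccs" using w(1) vH by (intro H.induce_reachable_is_in_sccs) simp
    have sub: "{v, w} \<subseteq> verts ?C" using vw w(1) vH by auto
    have "verts ?C \<subseteq> verts H" by (auto dest: H.reachable_in_verts)
    then have "card {v, w} \<le> card (verts ?C)"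
      using sub finite_subset[OF _ H.finite_verts] card_mono by metis
    then show "\<exists>C \<in> H.sccs. card (verts C) \<ge> 2 \<and> v \<in> verts C"
      using sub vw(2) by (intro bexI[OF _ C]) auto
  qed
qed

lemma playable_iff:
  "x \<in> playable X \<longleftrightarrow> x \<in> verts G \<and>
     (\<exists>v w. v \<rightarrow> w \<and> v \<notin> closed_neighborhood X \<and> w \<notin> closed_neighborhood X \<and>
       v \<in> closed_neighborhood {x})"
proof -
  have "(\<exists>C \<in> components_left X. card (verts C) \<ge> 2 \<and> v \<in> verts C)
      \<longleftrightarrow> v \<notin> closed_neighborhood X \<and> (\<exists>w. v \<rightarrow> w \<and> w \<notin> closed_neighborhood X)" for v
    unfolding components_left_def live_in_component_iff[OF refl Diff_subset]
    by (blast intro: adj_in_verts)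
  then show ?thesis unfolding playable_def by blast
qed

lemma finite_playable: "finite (playable X)"
  by (rule finite_subset[of _ "verts G"]) (auto simp: playable_def)

section \<open>Bounding the game value by a potential\<close>

lemma Dominator_le:
  "x \<in> playable X \<Longrightarrow> moves_left Dominator X \<le> Suc (moves_left Staller (insert x X))"
  by (auto simp: moves_left.simps(1)[of X] finite_playable intro!: Min_le)

lemma Dominator_ge:
  assumes "playable X \<noteq> {}" "\<And>x. x \<in> playable X \<Longrightarrow> k \<le> moves_left Staller (insert x X)"
  shows "Suc k \<le> moves_left Dominator X"
  using assms by (simp add: moves_left.simps(1)[of X] finite_playable)

lemma Staller_ge:
  "x \<in> playable X \<Longrightarrow> Suc (moves_left Dominator (insert x X)) \<le> moves_left Staller X"
  by (auto simp: moves_left.simps(2)[of X] finite_playable intro!: Max_ge)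

lemma Staller_le:
  assumes "\<And>x. x \<in> playable X \<Longrightarrow> Suc (moves_left Dominator (insert x X)) \<le> k"
  shows "moves_left Staller X \<le> k"
proof (cases "playable X = {}")
  case False
  have "Max ((\<lambda>x. moves_left Dominator (insert x X)) ` playable X)
      \<in> (\<lambda>x. moves_left Dominator (insert x X)) ` playable X"
    using False finite_playable by (intro Max_in) auto
  then show ?thesis using False assms by (auto simp: moves_left.simps(2)[of X])
qed (simp add: moves_left.simps)

text \<open>Induction on the number of unselected vertices. \<open>dom\<close> limits every move,
  \<open>stall\<close> asks for one slow move, and monotonicity of the round counts absorbs any
  slack. By \<open>over\<close> the game cannot stop while weight remains.\<close>

lemma moves_left_ge_rounds:
  fixes W :: "'a set \<Rightarrow> nat"
  assumes inv: "\<And>X x. I X \<Longrightarrow> x \<in> playable X \<Longrightarrow> I (insert x X)"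
    and over: "\<And>X. I X \<Longrightarrow> playable X = {} \<Longrightarrow> W X = 0"
    and dom: "\<And>X x. I X \<Longrightarrow> x \<in> playable X \<Longrightarrow> W X \<le> W (insert x X) + 4"
    and stall: "\<And>X. I X \<Longrightarrow> playable X \<noteq> {} \<Longrightarrow> \<exists>x\<in>playable X. W X \<le> W (insert x X) + 1"
  shows "I X \<Longrightarrow> dom_rounds (W X) \<le> moves_left Dominator X \<and>
    stall_rounds (W X) \<le> moves_left Staller X"
proof (induction "card (verts G - X)" arbitrary: X rule: less_induct)
  case less
  have IH: "dom_rounds (W (insert x X)) \<le> moves_left Dominator (insert x X)"
      "stall_rounds (W (insert x X)) \<le> moves_left Staller (insert x X)" if "x \<in> playable X" for x
  proof -
    have "card (verts G - insert x X) < card (verts G - X)"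
      using playable_new[OF that] by (intro psubset_card_mono) auto
    from less.hyps[OF this inv[OF less.prems that]]
    show "dom_rounds (W (insert x X)) \<le> moves_left Dominator (insert x X)"
      "stall_rounds (W (insert x X)) \<le> moves_left Staller (insert x X)" by auto
  qed
  show ?case
  proof (cases "W X = 0")
    case False
    then have ne: "playable X \<noteq> {}" using over[OF less.prems] by auto
    have "stall_rounds (W X - 4) \<le> moves_left Staller (insert x X)" if "x \<in> playable X" for x
      using dom[OF less.prems that] IH(2)[OF that]
        stall_rounds_mono[of "W X - 4" "W (insert x X)"] by linarith
    then have 1: "dom_rounds (W X) \<le> moves_left Dominator X"
      using Dominator_ge[OF ne] False by (simp add: dom_rounds_rec)
    obtain x where x: "x \<in> playable X" "W X \<le> W (insert x X) + 1"
      using stall[OF less.prems ne] by blast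
    then have "dom_rounds (W X - 1) \<le> dom_rounds (W (insert x X))"
      by (intro dom_rounds_mono) simp
    then have "stall_rounds (W X) \<le> moves_left Staller X"
      using False IH(1)[OF x(1)] Staller_ge[OF x(1)] by (simp add: stall_rounds_rec)
    with 1 show ?thesis by simp
  qed (simp add: rounds_0)
qed

text \<open>The mirrored induction: Dominator needs one good move, and every move must make
  progress. Positivity of \<open>W X\<close> while moves remain makes the recursions applicable;
  truncated subtraction allows a Dominator move that takes less than 4 when less is left.\<close>

lemma moves_left_le_rounds:
  fixes W :: "'a set \<Rightarrow> nat"
  assumes inv: "\<And>X x. I X \<Longrightarrow> x \<in> playable X \<Longrightarrow> I (insert x X)"
    and dom: "\<And>X. I X \<Longrightarrow> playable X \<noteq> {} \<Longrightarrow>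
      W X > 0 \<and> (\<exists>x\<in>playable X. W (insert x X) \<le> W X - 4)"
    and stall: "\<And>X x. I X \<Longrightarrow> x \<in> playable X \<Longrightarrow> W (insert x X) \<le> W X - 1"
  shows "I X \<Longrightarrow> moves_left Dominator X \<le> dom_rounds (W X) \<and>
    moves_left Staller X \<le> stall_rounds (W X)"
proof (induction "card (verts G - X)" arbitrary: X rule: less_induct)
  case less
  have IH: "moves_left Dominator (insert x X) \<le> dom_rounds (W (insert x X))"
      "moves_left Staller (insert x X) \<le> stall_rounds (W (insert x X))" if "x \<in> playable X" for x
  proof -
    have "card (verts G - insert x X) < card (verts G - X)"
      using playable_new[OF that] by (intro psubset_card_mono) auto
    from less.hyps[OF this inv[OF less.prems that]]
    show "moves_left Dominator (insert x X) \<le> dom_rounds (W (insert x X))"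
      "moves_left Staller (insert x X) \<le> stall_rounds (W (insert x X))" by auto
  qed
  show ?case
  proof (cases "playable X = {}")
    case False
    from dom[OF less.prems False] obtain x where
      x: "W X > 0" "x \<in> playable X" "W (insert x X) \<le> W X - 4" by blast
    have 1: "moves_left Dominator X \<le> dom_rounds (W X)"
      using IH(2)[OF x(2)] Dominator_le[OF x(2)] stall_rounds_mono[OF x(3)]
      by (simp add: dom_rounds_rec[OF x(1)])
    have "Suc (moves_left Dominator (insert y X)) \<le> stall_rounds (W X)"
      if "y \<in> playable X" for y
      using IH(1)[OF that] dom_rounds_mono[OF stall[OF less.prems that]]
      by (simp add: stall_rounds_rec[OF x(1)])
    with 1 show ?thesis by (intro conjI Staller_le)
  qed (simp add: moves_left.simps)
qed

end

section \<open>Edges and runs in finite sets of integers\<close>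

definition edges_at :: "int set \<Rightarrow> int set" where
  "edges_at U = {i. i \<in> U \<and> i + 1 \<in> U}"

text \<open>A component is represented by the position just before its first vertex.\<close>

definition runs_at :: "int set \<Rightarrow> int set" where
  "runs_at U = {i. i \<notin> U \<and> i + 1 \<in> U \<and> i + 2 \<in> U}"

definition run_weight :: "int set \<Rightarrow> nat" where
  "run_weight U = card (edges_at U) + 3 * card (runs_at U)"

lemma finite_edges_at: "finite U \<Longrightarrow> finite (edges_at U)"
  by (rule finite_subset[of _ U]) (auto simp: edges_at_def)

lemma finite_runs_at: "finite U \<Longrightarrow> finite (runs_at U)"
  by (rule finite_subset[of _ "(\<lambda>i. i - 1) ` U"]) (auto simp: runs_at_def image_iff, force)

lemma card_edges_at_remove3:
  assumes "finite U"
  shows "card (edges_at U) \<le> card (edges_at (U - {x - 1, x, x + 1})) + 4"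
proof -
  have "edges_at U \<subseteq> edges_at (U - {x - 1, x, x + 1}) \<union> {x - 2, x - 1, x, x + 1}"
    by (auto simp: edges_at_def)
  then have "card (edges_at U) \<le> card (edges_at (U - {x - 1, x, x + 1}) \<union> {x - 2, x - 1, x, x + 1})"
    using assms by (intro card_mono) (simp_all add: finite_edges_at)
  also have "\<dots> \<le> card (edges_at (U - {x - 1, x, x + 1})) + card {x - 2, x - 1, x, x + 1}"
    by (rule card_Un_le)
  finally show ?thesis by simp
qed

lemma card_edges_at_remove1:
  assumes "finite U" "x - 1 \<notin> U \<or> x + 1 \<notin> U"
  shows "card (edges_at U) \<le> card (edges_at (U - {x})) + 1"
proof -
  \<comment> \<open>The left endpoint of the only edge that can be lost at \<open>x\<close>.\<close>
  define e where "e = (if x - 1 \<in> U then x - 1 else x)"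
  have "edges_at U \<subseteq> insert e (edges_at (U - {x}))"
    using assms(2) by (auto simp: edges_at_def e_def)
  then have "card (edges_at U) \<le> card (insert e (edges_at (U - {x})))"
    using assms by (intro card_mono) (simp_all add: finite_edges_at)
  also have "\<dots> \<le> card (edges_at (U - {x})) + 1"
    by (simp add: card_insert_le_m1 card_insert_if)
  finally show ?thesis .
qed

text \<open>The share of a single position in \<open>run_weight\<close>. It depends only on
  \<open>i\<close>, \<open>i + 1\<close> and \<open>i + 2\<close>, so the effect of a move becomes a
  finite local computation.\<close>

definition run_weight_at :: "int set \<Rightarrow> int \<Rightarrow> nat" where
  "run_weight_at U i = of_bool (i \<in> U \<and> i + 1 \<in> U) +
     3 * of_bool (i \<notin> U \<and> i + 1 \<in> U \<and> i + 2 \<in> U)"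

lemma run_weight_eq_sum:
  assumes "finite I" "edges_at U \<subseteq> I" "runs_at U \<subseteq> I"
  shows "run_weight U = (\<Sum>i\<in>I. run_weight_at U i)"
proof -
  have "edges_at U = I \<inter> {i. i \<in> U \<and> i + 1 \<in> U}"
    "runs_at U = I \<inter> {i. i \<notin> U \<and> i + 1 \<in> U \<and> i + 2 \<in> U}"
    using assms(2,3) by (auto simp: edges_at_def runs_at_def)
  then show ?thesis using assms(1)
    by (simp add: run_weight_def run_weight_at_def sum.distrib flip: sum_distrib_left)
qed

lemma run_weight_remove3:
  fixes U :: "int set" and x :: int
  assumes "finite U"
  defines "V \<equiv> U - {x - 1, x, x + 1}" and "J \<equiv> {x - 3, x - 2, x - 1, x, x + 1, x + 2}"
  shows "run_weight U + sum (run_weight_at V) J = run_weight V + sum (run_weight_at U) J"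
proof -
  \<comment> \<open>A common finite index set on which both weights are sums.\<close>
  define I where "I = edges_at U \<union> runs_at U \<union> edges_at V \<union> runs_at V \<union> J"
  have fin: "finite I"
    using assms(1) by (simp add: I_def V_def J_def finite_edges_at finite_runs_at)
  have J: "J \<subseteq> I" by (simp add: I_def)
  have "run_weight_at U i = run_weight_at V i" if "i \<in> I - J" for i
    using that by (auto simp: V_def J_def run_weight_at_def of_bool_def)
  then have "sum (run_weight_at U) (I - J) = sum (run_weight_at V) (I - J)" by simp
  moreover have "run_weight U = sum (run_weight_at U) (I - J) + sum (run_weight_at U) J"
      "run_weight V = sum (run_weight_at V) (I - J) + sum (run_weight_at V) J"
    using run_weight_eq_sum[OF fin] sum.subset_diff[OF J fin]
    by (force simp: I_def)+
  ultimately show ?thesis by simp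
qed


text \<open>Removing \<open>x - 1, x, x + 1\<close> changes only the contributions of \<open>x - 3, \<dots>, x + 2\<close>.\<close>

lemma run_weight_window:
  fixes U :: "int set" and x :: int
  assumes "finite U"
  shows "run_weight U + of_bool (x - 3 \<in> U \<and> x - 2 \<in> U) + 4 * of_bool (x + 2 \<in> U \<and> x + 3 \<in> U) +
      3 * of_bool (x + 2 \<notin> U \<and> x + 3 \<in> U \<and> x + 4 \<in> U) =
    run_weight (U - {x - 1, x, x + 1}) +
      of_bool (x - 3 \<in> U \<and> x - 2 \<in> U) + of_bool (x - 2 \<in> U \<and> x - 1 \<in> U) +
      of_bool (x - 1 \<in> U \<and> x \<in> U) + of_bool (x \<in> U \<and> x + 1 \<in> U) +
      of_bool (x + 1 \<in> U \<and> x + 2 \<in> U) + of_bool (x + 2 \<in> U \<and> x + 3 \<in> U) +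
      3 * of_bool (x - 3 \<notin> U \<and> x - 2 \<in> U \<and> x - 1 \<in> U) +
      3 * of_bool (x - 2 \<notin> U \<and> x - 1 \<in> U \<and> x \<in> U) +
      3 * of_bool (x - 1 \<notin> U \<and> x \<in> U \<and> x + 1 \<in> U) +
      3 * of_bool (x \<notin> U \<and> x + 1 \<in> U \<and> x + 2 \<in> U) +
      3 * of_bool (x + 1 \<notin> U \<and> x + 2 \<in> U \<and> x + 3 \<in> U) +
      3 * of_bool (x + 2 \<notin> U \<and> x + 3 \<in> U \<and> x + 4 \<in> U)"
  using run_weight_remove3[OF assms, of x] by (simp add: run_weight_at_def algebra_simps)

text \<open>Only the run after \<open>x + 1\<close> can be new. Its surcharge is paid either by a
  run start lost further left together with a lost edge, or by the loss of all four edges from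
  \<open>x - 2\<close> to \<open>x + 2\<close>.\<close>

lemma run_weight_move_less:
  assumes "finite U" and gap: "x - 1 \<in> U \<and> x + 1 \<in> U \<longrightarrow> x \<in> U"
    and i: "i \<in> U" "i + 1 \<in> U \<or> i - 1 \<in> U" "i \<in> {x - 1, x, x + 1}"
  shows "run_weight (U - {x - 1, x, x + 1}) + 1 \<le> run_weight U"
proof -
  have "x - 2 \<in> U \<and> x - 1 \<in> U \<or> x - 1 \<in> U \<and> x \<in> U \<or> x \<in> U \<and> x + 1 \<in> U \<or> x + 1 \<in> U \<and> x + 2 \<in> U"
    using i by (auto simp: algebra_simps)
  then show ?thesis
    using run_weight_window[OF assms(1), of x] gap by (auto simp: of_bool_def split: if_splits)
qed

text \<open>The leftmost edge opens a run: a preceding element of \<open>U\<close> would give an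
  edge further left.\<close>

lemma runs_at_nonempty:
  assumes "finite U" "edges_at U \<noteq> {}"
  shows "runs_at U \<noteq> {}"
proof -
  let ?m = "Min (edges_at U)"
  have "?m \<in> edges_at U" "?m - 1 \<notin> edges_at U"
    using Min_in[OF finite_edges_at] Min_le[OF finite_edges_at, of U "?m - 1"] assms by auto
  then have "?m - 1 \<in> runs_at U" by (auto simp: edges_at_def runs_at_def add.commute)
  then show ?thesis by blast
qed

lemma run_weight_move_4:
  assumes "finite U" "edges_at U \<noteq> {}"
  shows "\<exists>x\<in>U. (x + 1 \<in> U \<or> x - 1 \<in> U) \<and> run_weight (U - {x - 1, x, x + 1}) + 4 \<le> run_weight U"
proof -
  obtain r where "r \<in> runs_at U" using runs_at_nonempty[OF assms] by blast
  then have r: "r \<notin> U" "r + 1 \<in> U" "r + 2 \<in> U" by (auto simp: runs_at_def)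
  show ?thesis
  proof (cases "r + 3 \<in> U \<and> r + 4 \<in> U")
    case True
    \<comment> \<open>The vertex \<open>r + 1\<close> becomes isolated, so the surcharge at
      \<open>r\<close> is freed and pays for a possible new run after \<open>r + 4\<close>. If
      \<open>r + 5\<close> is in \<open>U\<close>, four edges vanish; otherwise three edges and the
      whole surcharge do.\<close>
    define x where "x = r + 3"
    have x: "x - 3 \<notin> U" "x - 2 \<in> U" "x - 1 \<in> U" "x \<in> U" "x + 1 \<in> U"
      using r True by (simp_all add: x_def algebra_simps)
    then have "run_weight (U - {x - 1, x, x + 1}) + 4 \<le> run_weight U"
      using run_weight_window[OF assms(1), of x] by (auto simp: of_bool_def split: if_splits)
    then show ?thesis using x by blast
  next
    case False
    \<comment> \<open>The run has two or three vertices. Its second vertex clears it, which saves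
      the surcharge and at least one edge.\<close>
    define x where "x = r + 2"
    have x: "x - 2 \<notin> U" "x - 1 \<in> U" "x \<in> U" "\<not> (x + 1 \<in> U \<and> x + 2 \<in> U)"
      using r False by (simp_all add: x_def algebra_simps)
    then have "run_weight (U - {x - 1, x, x + 1}) + 4 \<le> run_weight U"
      using run_weight_window[OF assms(1), of x] by (auto simp: of_bool_def split: if_splits)
    then show ?thesis using x by blast
  qed
qed

text \<open>Provides Staller's slow move. Walking from an edge towards \<open>u\<close>, the first
  position outside \<open>U\<close> borders the run of that edge, and it stays in
  \<open>{a..b}\<close> because it lies between the edge and \<open>u\<close>.\<close>

lemma run_end_exists:
  fixes U :: "int set"
  assumes "finite U" "edges_at U \<noteq> {}" "u \<notin> U" "a \<le> u" "u \<le> b" "U \<subseteq> {a..b}"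
  shows "\<exists>y\<in>{a..b} - U. (y + 1 \<in> U \<and> y + 2 \<in> U) \<or> (y - 1 \<in> U \<and> y - 2 \<in> U)"
proof -
  obtain i where i: "i \<in> U" "i + 1 \<in> U" using assms(2) by (auto simp: edges_at_def)
  show ?thesis
  proof (cases "u < i")
    case True
    define y where "y = Max ({u..i} - U)"
    have "u \<in> {u..i} - U" "finite ({u..i} - U)" using True assms(3) by auto
    then have y: "y \<in> {u..i} - U" and max: "\<And>z. z \<in> {u..i} - U \<Longrightarrow> z \<le> y"
      unfolding y_def using Max_in Max_ge by blast+
    have "y \<noteq> i" using y i by auto
    then have "y + 1 \<in> U" using max[of "y + 1"] y by force
    moreover have "y + 2 \<in> U"
    proof (cases "y + 1 = i")
      case True
      then have "y + 2 = i + 1" by simp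
      then show ?thesis using i(2) by metis
    next
      case False
      then show ?thesis using max[of "y + 2"] y \<open>y \<noteq> i\<close> by force
    qed
    moreover have "y \<in> {a..b}" using y assms(4,6) i by auto
    ultimately show ?thesis using y by blast
  next
    case False
    define y where "y = Min ({i..u} - U)"
    have "u \<in> {i..u} - U" "finite ({i..u} - U)" using False assms(3) by auto
    then have y: "y \<in> {i..u} - U" and min: "\<And>z. z \<in> {i..u} - U \<Longrightarrow> y \<le> z"
      unfolding y_def using Min_in Min_le by blast+
    have ne: "y \<noteq> i" "y \<noteq> i + 1" using y i by auto
    then have "y - 1 \<in> U" using min[of "y - 1"] y by force
    moreover have "y - 2 \<in> U" using min[of "y - 2"] y ne by force
    moreover have "y \<in> {a..b}" using y assms(5,6) i by auto
    ultimately show ?thesis using y by blast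
  qed
qed

section \<open>The game on a path as removal of integer positions\<close>

text \<open>
  Integer positions avoid truncated subtraction. Since \<open>nat 0 = 0\<close>, the definition
  is meant for \<open>X \<subseteq> {1..n}\<close>.
\<close>

definition undominated :: "nat \<Rightarrow> nat set \<Rightarrow> int set" where
  "undominated n X = {i. 1 \<le> i \<and> i \<le> int n \<and> nat (i - 1) \<notin> X \<and> nat i \<notin> X \<and> nat (i + 1) \<notin> X}"

lemma finite_undominated [simp]: "finite (undominated n X)"
  by (rule finite_subset[of _ "{1..int n}"]) (auto simp: undominated_def)

lemma verts_path_graph [simp]: "verts (path_graph n) = {1..n}"
  by (simp add: path_graph_def)

lemma path_graph_adj:
  "u \<rightarrow>\<^bsub>path_graph n\<^esub> v \<longleftrightarrow> u \<in> {1..n} \<and> v \<in> {1..n} \<and> (v = Suc u \<or> u = Suc v)"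
  by (auto simp: path_graph_def arcs_ends_def arc_to_ends_def image_iff)

lemma path_closed_neighborhood:
  assumes "X \<subseteq> {1..n}" "v \<in> {1..n}"
  shows "v \<in> graph.closed_neighborhood (path_graph n) X \<longleftrightarrow> int v \<notin> undominated n X"
proof -
  have "nat (int v - 1) = v - 1" "nat (int v) = v" "nat (int v + 1) = Suc v" by auto
  then have "int v \<in> undominated n X \<longleftrightarrow> v - 1 \<notin> X \<and> v \<notin> X \<and> Suc v \<notin> X"
    using assms(2) by (simp only: undominated_def mem_Collect_eq) auto
  \<comment> \<open>For \<open>v = 1\<close> the truncated \<open>v - 1\<close> is 0, which is not
    in \<open>X\<close>.\<close>
  moreover have "u \<rightarrow>\<^bsub>path_graph n\<^esub> v \<longleftrightarrow> u = v - 1 \<or> u = Suc v" if "u \<in> X" for u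
    using that assms by (auto simp: path_graph_adj)
  then have "v \<in> graph.closed_neighborhood (path_graph n) X \<longleftrightarrow> v \<in> X \<or> v - 1 \<in> X \<or> Suc v \<in> X"
    using assms unfolding graph.closed_neighborhood_def[OF graph_path_graph] by auto
  ultimately show ?thesis by blast
qed

text \<open>Since \<open>x > 0\<close>, \<open>nat j = x\<close> forces
  \<open>j = int x\<close>.\<close>

lemma undominated_insert:
  assumes "x \<in> {1..n}"
  shows "undominated n (insert x X) = undominated n X - {int x - 1, int x, int x + 1}"
  using assms by (auto simp: undominated_def)

text \<open>Each of the three vertices that could dominate \<open>i\<close> also dominates
  \<open>i - 1\<close> or \<open>i + 1\<close>.\<close>

lemma undominated_no_gap:
  "\<lbrakk>i - 1 \<in> undominated n X; i + 1 \<in> undominated n X\<rbrakk> \<Longrightarrow> i \<in> undominated n X"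
  by (auto simp: undominated_def)

lemma path_playable_iff:
  assumes "X \<subseteq> {1..n}"
  defines "U \<equiv> undominated n X"
  shows "x \<in> graph.playable (path_graph n) X \<longleftrightarrow> x \<in> {1..n} \<and>
    (\<exists>i\<in>U. (i + 1 \<in> U \<or> i - 1 \<in> U) \<and> i \<in> {int x - 1, int x, int x + 1})"
    (is "?L \<longleftrightarrow> ?R")
proof -
  interpret graph "path_graph n" by (rule graph_path_graph)
  have near: "v \<in> closed_neighborhood {x} \<longleftrightarrow> int v \<in> {int x - 1, int x, int x + 1}"
    if "x \<in> {1..n}" "v \<in> {1..n}" for v
    using that by (auto simp: closed_neighborhood_def path_graph_adj)
  have U: "v \<in> closed_neighborhood X \<longleftrightarrow> int v \<notin> U" if "v \<in> {1..n}" for v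
    unfolding U_def by (rule path_closed_neighborhood[OF assms(1) that])
  show ?thesis
  proof
    assume ?L
    then obtain v w where vw: "x \<in> {1..n}" "v \<rightarrow>\<^bsub>path_graph n\<^esub> w" "v \<notin> closed_neighborhood X"
      "w \<notin> closed_neighborhood X" "v \<in> closed_neighborhood {x}"
      by (auto simp: playable_iff)
    then have "v \<in> {1..n}" "w \<in> {1..n}" "int w = int v + 1 \<or> int w = int v - 1"
      by (auto simp: path_graph_adj)
    then show ?R using vw near U by (intro conjI bexI[of _ "int v"]) auto
  next
    assume ?R
    then obtain i j where ij: "x \<in> {1..n}" "i \<in> U" "j \<in> U" "j = i + 1 \<or> j = i - 1"
      "i \<in> {int x - 1, int x, int x + 1}" by blast
    then have 1: "nat i \<in> {1..n}" "nat j \<in> {1..n}" "int (nat i) = i" "int (nat j) = j"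
      by (auto simp: U_def undominated_def)
    then have "nat i \<rightarrow>\<^bsub>path_graph n\<^esub> nat j" using ij(4) by (auto simp: path_graph_adj)
    then show ?L using ij 1 near[of "nat i"] U[of "nat i"] U[of "nat j"]
      by (auto simp: playable_iff)
  qed
qed

lemma path_playable_empty_iff:
  assumes "X \<subseteq> {1..n}"
  shows "graph.playable (path_graph n) X = {} \<longleftrightarrow> edges_at (undominated n X) = {}"
proof
  assume e: "graph.playable (path_graph n) X = {}"
  show "edges_at (undominated n X) = {}"
  proof (rule ccontr)
    assume "edges_at (undominated n X) \<noteq> {}"
    then obtain i where i: "i \<in> undominated n X" "i + 1 \<in> undominated n X"
      by (auto simp: edges_at_def)
    then have "nat i \<in> graph.playable (path_graph n) X"
      unfolding path_playable_iff[OF assms] by (auto simp: undominated_def intro!: bexI[of _ i])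
    with e show False by blast
  qed
next
  assume "edges_at (undominated n X) = {}"
  then have "i \<in> undominated n X \<Longrightarrow> i + 1 \<notin> undominated n X \<and> i - 1 \<notin> undominated n X" for i
    by (auto simp: edges_at_def)
  then show "graph.playable (path_graph n) X = {}"
    using path_playable_iff[OF assms] by blast
qed

section \<open>The two bounds for positions on a path\<close>

text \<open>A selected vertex is a dominated position from which \<open>run_end_exists\<close> can
  start; the untouched path has none.\<close>

lemma path_moves_left_ge:
  assumes "X \<subseteq> {1..n}" "X \<noteq> {}"
  shows "dom_rounds (card (edges_at (undominated n X))) \<le> graph.moves_left (path_graph n) Dominator X \<and>
    stall_rounds (card (edges_at (undominated n X))) \<le> graph.moves_left (path_graph n) Staller X"
proof -
  interpret graph "path_graph n" by (rule graph_path_graph)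
  show ?thesis
  proof (rule moves_left_ge_rounds[where I = "\<lambda>X. X \<subseteq> {1..n} \<and> X \<noteq> {}"])
    fix X x assume X: "X \<subseteq> {1..n} \<and> X \<noteq> {}" and x: "x \<in> playable X"
    then have "x \<in> {1..n}" using playable_new(1) by fastforce
    then show "insert x X \<subseteq> {1..n} \<and> insert x X \<noteq> {}" using X by auto
    show "card (edges_at (undominated n X)) \<le> card (edges_at (undominated n (insert x X))) + 4"
      using card_edges_at_remove3[of "undominated n X" "int x"]
      by (simp add: undominated_insert[OF \<open>x \<in> {1..n}\<close>])
  next
    fix X assume X: "X \<subseteq> {1..n} \<and> X \<noteq> {}"
    show "card (edges_at (undominated n X)) = 0" if "playable X = {}"
      using that X path_playable_empty_iff by simp
    assume "playable X \<noteq> {}"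
    then have ne: "edges_at (undominated n X) \<noteq> {}" using X path_playable_empty_iff by blast
    obtain u where u: "u \<in> X" "u \<in> {1..n}" using X by blast
    have "int u \<notin> undominated n X" "1 \<le> int u" "int u \<le> int n" "undominated n X \<subseteq> {1..int n}"
      using u by (auto simp: undominated_def)
    from run_end_exists[OF finite_undominated ne this] obtain y where
      y: "y \<in> {1..int n} - undominated n X"
        "(y + 1 \<in> undominated n X \<and> y + 2 \<in> undominated n X) \<or>
         (y - 1 \<in> undominated n X \<and> y - 2 \<in> undominated n X)"
      by blast
    define U where "U = undominated n X"
    have ny: "nat y \<in> {1..n}" "int (nat y) = y" using y by auto
    obtain z w where z: "z \<in> U" "w \<in> U" "z = y + 1 \<and> w = z + 1 \<or> z = y - 1 \<and> w = z - 1"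
      using y(2) by (fastforce simp: U_def)
    \<comment> \<open>As \<open>y\<close> is dominated, its two neighbours cannot both be
      undominated, so playing \<open>y\<close> removes \<open>z\<close> alone.\<close>
    have "y \<notin> U" and gap: "y - 1 \<notin> U \<or> y + 1 \<notin> U"
      using y(1) undominated_no_gap[of y n X] by (auto simp: U_def)
    then have "undominated n (insert (nat y) X) = U - {z}"
      using z(1,3) ny by (auto simp: undominated_insert U_def)
    moreover have "card (edges_at U) \<le> card (edges_at (U - {z})) + 1"
      using z(3) \<open>y \<notin> U\<close> by (intro card_edges_at_remove1) (auto simp: U_def)
    moreover have "nat y \<in> playable X"
      using X ny z by (auto simp: path_playable_iff U_def intro!: bexI[of _ z])
    ultimately show "\<exists>x\<in>playable X. card (edges_at (undominated n X))
        \<le> card (edges_at (undominated n (insert x X))) + 1"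
      unfolding U_def by metis
  qed (use assms in auto)
qed

lemma path_moves_left_le:
  assumes "X \<subseteq> {1..n}"
  shows "graph.moves_left (path_graph n) Dominator X \<le> dom_rounds (run_weight (undominated n X) - 3) \<and>
    graph.moves_left (path_graph n) Staller X \<le> stall_rounds (run_weight (undominated n X) - 3)"
proof -
  interpret graph "path_graph n" by (rule graph_path_graph)
  show ?thesis
  proof (rule moves_left_le_rounds[where I = "\<lambda>X. X \<subseteq> {1..n}"])
    fix X x assume X: "X \<subseteq> {1..n}" and x: "x \<in> playable X"
    then have x': "x \<in> {1..n}" using playable_new(1) by fastforce
    then show "insert x X \<subseteq> {1..n}" using X by auto
    obtain i where "i \<in> undominated n X" "i + 1 \<in> undominated n X \<or> i - 1 \<in> undominated n X"
      "i \<in> {int x - 1, int x, int x + 1}"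
      using x path_playable_iff[OF X] by blast
    then have "run_weight (undominated n (insert x X)) + 1 \<le> run_weight (undominated n X)"
      unfolding undominated_insert[OF x']
      using undominated_no_gap by (intro run_weight_move_less) auto
    then show "run_weight (undominated n (insert x X)) - 3 \<le> run_weight (undominated n X) - 3 - 1"
      by simp
  next
    fix X assume X: "X \<subseteq> {1..n}" and "playable X \<noteq> {}"
    then have ne: "edges_at (undominated n X) \<noteq> {}" using path_playable_empty_iff by blast
    \<comment> \<open>An edge and a run together weigh at least 4, so subtracting 3 leaves a
      positive weight.\<close>
    then have "card (edges_at (undominated n X)) > 0" "card (runs_at (undominated n X)) > 0"
      using runs_at_nonempty by (simp_all add: card_gt_0_iff finite_edges_at finite_runs_at)
    then have "run_weight (undominated n X) - 3 > 0" by (simp add: run_weight_def)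
    moreover obtain x where x: "x \<in> undominated n X"
      "x + 1 \<in> undominated n X \<or> x - 1 \<in> undominated n X"
      "run_weight (undominated n X - {x - 1, x, x + 1}) + 4 \<le> run_weight (undominated n X)"
      using run_weight_move_4[OF _ ne] by auto
    then have nx: "nat x \<in> {1..n}" "int (nat x) = x" by (auto simp: undominated_def)
    then have "nat x \<in> playable X" using x X by (auto simp: path_playable_iff)
    moreover have "run_weight (undominated n (insert (nat x) X)) - 3 \<le> run_weight (undominated n X) - 3 - 4"
      using x(3) nx by (simp add: undominated_insert)
    ultimately show "run_weight (undominated n X) - 3 > 0 \<and> (\<exists>x\<in>playable X.
        run_weight (undominated n (insert x X)) - 3 \<le> run_weight (undominated n X) - 3 - 4)"
      by blast
  qed (rule assms)
qed

section \<open>Evaluation at the initial position\<close>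

lemma edges_at_atLeastAtMost: "edges_at {a..b} = {a..b - 1}"
  by (auto simp: edges_at_def)

lemma undominated_empty: "undominated n {} = {1..int n}"
  by (auto simp: undominated_def)

lemma path_game_isolation_number:
  assumes "n \<ge> 2"
  shows "graph.game_isolation_number (path_graph n) = dom_rounds (n - 1)"
proof -
  interpret graph "path_graph n" by (rule graph_path_graph)
  have E: "card (edges_at (undominated n {})) = n - 1"
    by (simp add: undominated_empty edges_at_atLeastAtMost)
  \<comment> \<open>The whole path is a single run, whose surcharge cancels the subtracted
    3.\<close>
  have "runs_at {1..int n} = {0}" using assms by (auto simp: runs_at_def)
  then have "run_weight (undominated n {}) - 3 = n - 1"
    using E by (simp add: run_weight_def undominated_empty)
  then have "moves_left Dominator {} \<le> dom_rounds (n - 1)"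
    using path_moves_left_le[of "{}" n] by simp
  \<comment> \<open>The lower bound requires a selected vertex, so Dominator's first move is treated
    separately; \<open>dom_rounds_rec\<close> joins it to the rest.\<close>
  moreover have "Suc (stall_rounds (n - 1 - 4)) \<le> moves_left Dominator {}"
  proof (rule Dominator_ge)
    show "playable {} \<noteq> {}"
      using E assms path_playable_empty_iff[of "{}" n] by auto
    fix x assume "x \<in> playable {}"
    then have x: "x \<in> {1..n}" using playable_new(1) by fastforce
    then have "n - 1 - 4 \<le> card (edges_at (undominated n {x}))"
      using card_edges_at_remove3[of "undominated n {}" "int x"] E
      by (simp add: undominated_insert)
    then have "stall_rounds (n - 1 - 4) \<le> stall_rounds (card (edges_at (undominated n {x})))"
      by (rule stall_rounds_mono)
    also have "\<dots> \<le> moves_left Staller {x}"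
      using path_moves_left_ge[of "{x}" n] x by simp
    finally show "stall_rounds (n - 1 - 4) \<le> moves_left Staller {x}" .
  qed
  ultimately show ?thesis
    using assms by (simp add: game_isolation_number_def dom_rounds_rec)
qed

text \<open>Opening at vertex 1 leaves the path from 3 to \<open>n\<close>, one edge fewer than the
  upper bound's count would allow. This loss does not change the number of rounds for the residues 0
  and 4.\<close>

lemma path_staller_game_isolation_number:
  assumes "n \<ge> 2"
  shows "Suc (dom_rounds (n - 3)) \<le> graph.staller_game_isolation_number (path_graph n)"
    and "graph.staller_game_isolation_number (path_graph n) \<le> stall_rounds (n - 1)"
proof -
  interpret graph "path_graph n" by (rule graph_path_graph)
  have "runs_at {1..int n} = {0}" using assms by (auto simp: runs_at_def)
  then have "run_weight (undominated n {}) - 3 = n - 1"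
    by (simp add: run_weight_def undominated_empty edges_at_atLeastAtMost)
  then show "staller_game_isolation_number \<le> stall_rounds (n - 1)"
    using path_moves_left_le[of "{}" n] by (simp add: staller_game_isolation_number_def)
  have "undominated n {1} = {3..int n}" by (auto simp: undominated_def)
  then have "card (edges_at (undominated n {1})) = n - 3"
    by (simp add: edges_at_atLeastAtMost)
  then have "dom_rounds (n - 3) \<le> moves_left Dominator {1}"
    using path_moves_left_ge[of "{1}" n] assms by auto
  moreover have "1 \<in> playable {}"
    using assms by (auto simp: path_playable_iff undominated_empty intro!: bexI[of _ 1])
  ultimately show "Suc (dom_rounds (n - 3)) \<le> staller_game_isolation_number"
    unfolding staller_game_isolation_number_def using Staller_ge[of 1 "{}"] by simp
qed

theorem theorem2p4:
  fixes n :: nat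
  assumes "n \<ge> 6"
    and "n mod 5 = 0 \<or> n mod 5 = 4"
  shows "int (graph.game_isolation_number (path_graph n)) = \<lceil>2 * real n / 5\<rceil> - 1 \<and>
         int (graph.staller_game_isolation_number (path_graph n)) = \<lfloor>(2 * real n + 2) / 5\<rfloor>"
proof -
  define k where "k = n div 5"
  have bounds: "Suc (dom_rounds (n - 3)) \<le> graph.staller_game_isolation_number (path_graph n)"
      "graph.staller_game_isolation_number (path_graph n) \<le> stall_rounds (n - 1)"
    using path_staller_game_isolation_number assms(1) by simp_all
  have D: "graph.game_isolation_number (path_graph n) = dom_rounds (n - 1)"
    using path_game_isolation_number assms(1) by simp
  from assms(2) show ?thesis
  proof
    assume "n mod 5 = 0"
    then have "k > 0" "n = 5 * k" using assms(1) by (auto simp: k_def)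
    then obtain j where j: "k = Suc j" and n: "n = 5 * k" using gr0_conv_Suc by blast
    have "n - 1 = 5 * j + 4" "n - 3 = 5 * j + 2" using n j by simp_all
    then have "dom_rounds (n - 1) = 2 * k - 1" "Suc (dom_rounds (n - 3)) = 2 * k"
        "stall_rounds (n - 1) = 2 * k"
      using j by (simp_all add: dom_rounds_def stall_rounds_def)
    moreover have "\<lceil>2 * real n / 5\<rceil> = int (2 * k)" "\<lfloor>(2 * real n + 2) / 5\<rfloor> = int (2 * k)"
      using n by (auto intro!: ceiling_unique floor_unique)
    ultimately show ?thesis using bounds D j by simp
  next
    assume "n mod 5 = 4"
    then have n: "n = 5 * k + 4" using mult_div_mod_eq[of 5 n] by (simp add: k_def)
    then have "n - 1 = 5 * k + 3" "n - 3 = 5 * k + 1" by simp_all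
    then have "dom_rounds (n - 1) = 2 * k + 1" "Suc (dom_rounds (n - 3)) = 2 * k + 2"
        "stall_rounds (n - 1) = 2 * k + 2"
      by (simp_all add: dom_rounds_def stall_rounds_def)
    \<comment> \<open>Here \<open>2 * n / 5\<close> is \<open>2 * k + 8 / 5\<close>, and
      \<open>(2 * n + 2) / 5\<close> is exactly \<open>2 * k + 2\<close>.\<close>
    moreover have "\<lceil>2 * real n / 5\<rceil> = int (2 * k + 2)" "\<lfloor>(2 * real n + 2) / 5\<rfloor> = int (2 * k + 2)"
      using n by (auto intro!: ceiling_unique floor_unique)
    ultimately show ?thesis using bounds D by simp
  qed
qed

end
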